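(* Let $p\geq 5$ be a prime, let $q$ be a power of $p$, let $a\in\mathbb{F}_q^*$, and let $k,d$ be positive integers. The polynomial $\mathfrak{D}_{k,4}=D_{k,4}(X^d,a)-D_{k,4}(0,a)\in\mathbb{F}_q[X]$ is a Dembowski-Ostrom (DO) polynomial over $\mathbb{F}_q$ if and only if one of the following holds: (i) $k=1$ and $d=p^n(p^{\alpha}+1)$ for some non-negative integers $\alpha$ and $n$. (ii) $k=2$ and $d=p^n(p^{\alpha}+1)/2$ for some non-negative integers $\alpha$ and $n$. (iii) $k=4$ and $d=p^n(p^{\alpha}+1)/4$ for some non-negative integers $\alpha$ and $n$. (iv) $k\in\{3,5\}$, $p=5$ and $d=2p^n$ for some non-negative integer $n$.
   Context: $\mathbb{F}_q$ is the finite field with $q$ elements and $\mathbb{F}_q^*$ is its multiplicative group of nonzero elements. For integers $k\ge 1$ and $m\ge 0$ and $a\in\mathbb{F}_q$, the $k$-th Dickson polynomial of the $(m+1)$-th kind is $$D_{k,m}(X,a)=\sum_{i=0}^{\lfloor k/2\rfloor}\frac{k-mi}{k-i}\binom{k-i}{i}(-a)^iX^{k-2i}\in\mathbb{F}_q[X],$$ where each coefficient $\frac{k-mi}{k-i}\binom{k-i}{i}$ is an integer, interpreted modulo $p$. For a positive integer $d$, $\mathfrak{D}_{k,m}:=D_{k,m}(X^d,a)-D_{k,m}(0,a)$, i.e. $D_{k,m}(X^d,a)$ with its constant term removed; explicitly $\mathfrak{D}_{k,m}=\sum_{i=0}^{\lfloor (k-1)/2\rfloor}\frac{k-mi}{k-i}\binom{k-i}{i}(-a)^iX^{(k-2i)d}$.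 A Dembowski-Ostrom (DO) polynomial over $\mathbb{F}_q$ ($q$ a power of $p$) is a polynomial in $\mathbb{F}_q[X]$ of the form $\sum_{i,j}a_{ij}X^{p^i+p^j}$ (finite sum over non-negative integers $i,j$, with $a_{ij}\in\mathbb{F}_q$). Polynomials are considered as formal polynomials, not reduced modulo $X^q-X$. *)

theory Defs
  imports "HOL-Computational_Algebra.Computational_Algebra"
begin

text \<open>
  The integer coefficient \<open>(k - m i) / (k - i) * binomial (k - i) i\<close>. For \<open>1 \<le> k\<close> and
  \<open>i \<le> k div 2\<close> the division is exact, see \<open>dickson_coeff_exact\<close> below.
\<close>

definition dickson_coeff :: "nat \<Rightarrow> nat \<Rightarrow> nat \<Rightarrow> int" where
  "dickson_coeff k m i =
     ((int k - int m * int i) * int ((k - i) choose i)) div (int k - int i)"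

lemma dickson_coeff_exact:
  assumes "1 \<le> k" "i \<le> k div 2"
  shows "(int k - int i) * dickson_coeff k m i
           = (int k - int m * int i) * int ((k - i) choose i)"
proof -
  obtain n where n: "k - i = Suc n" using assms by (cases "k - i") auto
  have k: "int k - int i = int (Suc n)" using n by simp
  have "int (Suc n) dvd int i * int (Suc n choose i)"
  proof (cases i)
    case (Suc j)
    have "int i * int (Suc n choose i) = int (Suc n) * int (n choose j)"
      unfolding Suc using Suc_times_binomial[of j n] by (metis of_nat_mult)
    then show ?thesis by (metis dvd_triv_left)
  qed simp
  then have "int (Suc n) dvd int (Suc n) * int (Suc n choose i)
      - (int m - 1) * (int i * int (Suc n choose i))"
    by (rule dvd_diff[OF dvd_triv_left dvd_mult])
  also have "\<dots> = (int k - int m * int i) * int (Suc n choose i)"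
    by (simp only: k[symmetric]) (simp add: algebra_simps)
  finally show ?thesis
    unfolding dickson_coeff_def n k by (rule dvd_mult_div_cancel)
qed

text \<open>\<open>dickson_poly k m a\<close> is the \<open>k\<close>-th Dickson polynomial of the \<open>(m+1)\<close>-th kind.\<close>

definition dickson_poly :: "nat \<Rightarrow> nat \<Rightarrow> 'a::comm_ring_1 \<Rightarrow> 'a poly" where
  "dickson_poly k m a =
     (\<Sum>i\<le>k div 2. monom (of_int (dickson_coeff k m i) * (- a) ^ i) (k - 2 * i))"

definition dickson_frak :: "nat \<Rightarrow> nat \<Rightarrow> nat \<Rightarrow> 'a::comm_ring_1 \<Rightarrow> 'a poly" where
  "dickson_frak k m d a =
     pcompose (dickson_poly k m a) (monom 1 d) - [:poly (dickson_poly k m a) 0:]"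

text \<open>
  Dembowski-Ostrom polynomials over a field of characteristic \<open>p\<close>, as formal polynomials.
\<close>

definition DO_poly :: "nat \<Rightarrow> 'a::comm_ring_1 poly \<Rightarrow> bool" where
  "DO_poly p f \<longleftrightarrow>
     (\<exists>(I :: (nat \<times> nat) set) c. finite I \<and>
        f = (\<Sum>(i, j)\<in>I. monom (c i j) (p ^ i + p ^ j)))"

end

theory Submission
  imports Defs
begin

text \<open>
  A polynomial is Dembowski-Ostrom exactly when every exponent that occurs in it has the form
  \<open>p\<^sup>i + p\<^sup>j\<close>; call such a number a DO exponent. The exponents of \<open>dickson_frak k 4 d a\<close> are the
  \<open>(k - 2i) d\<close> with \<open>2i < k\<close> whose coefficient \<open>c\<^sub>i\<close> is nonzero modulo \<open>p\<close>
  (\<open>DO_poly_dickson_frak_iff\<close>), so the theorem is a question about integers.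

  Two facts answer it. First, DO exponents are rigid: if \<open>u d\<close> and \<open>v d\<close> are DO exponents with
  \<open>v < u\<close>, and \<open>p\<close> divides none of \<open>u\<close>, \<open>v\<close>, \<open>u - v\<close>, then both have the same \<open>p\<close>-part
  \<open>p\<^sup>n\<close> as \<open>d\<close>, and dividing it out leaves \<open>p\<^sup>\<alpha> + 1\<close> and \<open>p\<^sup>\<beta> + 1\<close>. Their difference is
  prime to \<open>p\<close>, so \<open>\<beta> = 0\<close>, that is \<open>v d = 2 p\<^sup>n\<close>, and \<open>v\<close> divides 2
  (\<open>two_DO_multiples\<close>). Secondly, by \<open>fact_mult_dickson_coeff\<close>, \<open>c\<^sub>1 = k - 4\<close>,
  \<open>2 c\<^sub>2 = (k - 8) (k - 3)\<close> and \<open>24 c\<^sub>4 = (k - 16) (k - 5) (k - 6) (k - 7)\<close>. If \<open>k\<close> is 0 or 2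
  modulo \<open>p\<close>, then \<open>c\<^sub>1\<close> and \<open>c\<^sub>2\<close> are nonzero modulo \<open>p\<close>; if it is 4, then \<open>c\<^sub>2\<close> and
  \<open>c\<^sub>4\<close> are: all factors become numbers composed of 2 and 3 only.

  For \<open>k \<ge> 6\<close> this always yields a suitable pair \<open>(u, v)\<close> with \<open>u - v\<close> a power of 2:
  the pair \<open>(k, k - 2)\<close> in general, \<open>(k - 2, k - 4)\<close> if \<open>p\<close> divides \<open>k\<close>, \<open>(k, k - 4)\<close> if it
  divides \<open>k - 2\<close>, and \<open>(k, k - 8)\<close> if it divides \<open>k - 4\<close>. That \<open>v\<close> divides 2 then
  contradicts \<open>k \<ge> 6\<close> and the divisibility by \<open>p\<close>, except for \<open>k = 9\<close> and \<open>p = 5\<close>,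
  where \<open>9 \<cdot> 2 = 5\<^sup>\<alpha> + 1\<close> has no solution. For \<open>k = 3\<close> and \<open>k = 5\<close> the pair \<open>(3, 1)\<close> gives \<open>3 \<cdot> 2 = p\<^sup>\<alpha> + 1\<close>, hence \<open>p = 5\<close>. For
  \<open>k = 4\<close> the coefficient \<open>c\<^sub>1 = k - 4\<close> vanishes and only the leading term is left.
\<close>

section \<open>Exponents of Dembowski-Ostrom polynomials\<close>

definition DO_exponent :: "nat \<Rightarrow> nat \<Rightarrow> bool" where
  "DO_exponent p N \<longleftrightarrow> (\<exists>i j. N = p ^ i + p ^ j)"

lemma DO_exponent_iff: "DO_exponent p N \<longleftrightarrow> (\<exists>\<alpha> n. N = p ^ n * (p ^ \<alpha> + 1))"
proof
  assume "DO_exponent p N"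
  then obtain i j where N: "N = p ^ i + p ^ j"
    unfolding DO_exponent_def by blast
  have "N = p ^ min i j * (p ^ (max i j - min i j) + 1)"
  proof (cases "i \<le> j")
    case True
    then have "p ^ j = p ^ i * p ^ (j - i)" by (metis le_add_diff_inverse power_add)
    with True N show ?thesis by (simp add: algebra_simps)
  next
    case False
    then have "p ^ i = p ^ j * p ^ (i - j)" by (metis le_add_diff_inverse nat_le_linear power_add)
    with False N show ?thesis by (simp add: algebra_simps)
  qed
  then show "\<exists>\<alpha> n. N = p ^ n * (p ^ \<alpha> + 1)" by blast
next
  assume "\<exists>\<alpha> n. N = p ^ n * (p ^ \<alpha> + 1)"
  then obtain \<alpha> n where "N = p ^ (n + \<alpha>) + p ^ n"
    by (auto simp: algebra_simps power_add)
  then show "DO_exponent p N" unfolding DO_exponent_def by blast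
qed

text \<open>
  A pair \<open>(i, j)\<close> can be chosen for each exponent separately; distinct exponents get distinct
  pairs, so the chosen pairs index the terms without repetition.
\<close>

lemma DO_poly_iff:
  fixes f :: "'a::comm_ring_1 poly"
  shows "DO_poly p f \<longleftrightarrow> (\<forall>N. coeff f N \<noteq> 0 \<longrightarrow> DO_exponent p N)"
proof
  assume "DO_poly p f"
  then obtain I c where f: "f = (\<Sum>(i, j)\<in>I. monom (c i j) (p ^ i + p ^ j))"
    unfolding DO_poly_def by blast
  show "\<forall>N. coeff f N \<noteq> 0 \<longrightarrow> DO_exponent p N"
  proof (intro allI impI)
    fix N assume "coeff f N \<noteq> 0"
    then have "(\<Sum>(i, j)\<in>I. coeff (monom (c i j) (p ^ i + p ^ j)) N) \<noteq> 0"
      by (simp add: f coeff_sum case_prod_beta)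
    then obtain x where "coeff (monom (c (fst x) (snd x)) (p ^ fst x + p ^ snd x)) N \<noteq> 0"
      by (metis (no_types, lifting) case_prod_beta sum.neutral)
    then have "p ^ fst x + p ^ snd x = N" by (auto split: if_splits)
    then show "DO_exponent p N" unfolding DO_exponent_def by blast
  qed
next
  assume DO: "\<forall>N. coeff f N \<noteq> 0 \<longrightarrow> DO_exponent p N"
  define S where "S = {N. coeff f N \<noteq> 0}"
  have fin: "finite S"
    by (rule finite_subset[of _ "{..degree f}"]) (auto simp: S_def intro: le_degree)
  have "\<forall>N. \<exists>x. N \<in> S \<longrightarrow> N = p ^ fst x + p ^ snd x"
    using DO unfolding S_def DO_exponent_def by auto
  then obtain r where r: "\<And>N. N \<in> S \<Longrightarrow> N = p ^ fst (r N) + p ^ snd (r N)"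
    by metis
  have inj: "inj_on r S"
    by (rule inj_onI) (metis r)
  have "f = (\<Sum>N\<in>S. monom (coeff f N) N)"
    by (rule poly_eqI) (use fin in \<open>simp add: coeff_sum S_def\<close>)
  also have "\<dots> = (\<Sum>N\<in>S. monom (coeff f (p ^ fst (r N) + p ^ snd (r N)))
                            (p ^ fst (r N) + p ^ snd (r N)))"
    using r by (intro sum.cong) auto
  also have "\<dots> = (\<Sum>x\<in>r ` S. monom (coeff f (p ^ fst x + p ^ snd x)) (p ^ fst x + p ^ snd x))"
    using inj by (simp add: sum.reindex)
  also have "\<dots> = (\<Sum>(i, j)\<in>r ` S. monom (coeff f (p ^ i + p ^ j)) (p ^ i + p ^ j))"
    by (simp add: case_prod_beta)
  finally show "DO_poly p f"
    unfolding DO_poly_def using fin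
    by (intro exI[of _ "r ` S"] exI[of _ "\<lambda>i j. coeff f (p ^ i + p ^ j)"]) auto
qed

section \<open>The exponents of a Dickson polynomial\<close>

lemma pcompose_monom_monom:
  "pcompose (monom c n) (monom (1::'a::comm_ring_1) d) = monom c (n * d)"
proof (induction n)
  case 0
  then show ?case by (simp add: monom_0)
next
  case (Suc n)
  then show ?case by (simp add: monom_Suc pcompose_pCons mult_monom)
qed

lemma coeff_dickson_frak:
  assumes "d \<ge> 1"
  shows "coeff (dickson_frak k m d a) N = (if N = 0 then 0 else
     (\<Sum>i\<le>k div 2. if (k - 2 * i) * d = N then of_int (dickson_coeff k m i) * (- a) ^ i else 0))"
proof (cases "N = 0")
  case True
  have "coeff (monom (1::'a) d) 0 = 0" using assms by simp
  then show ?thesis using True by (simp add: dickson_frak_def)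
next
  case False
  then have "coeff [:poly (dickson_poly k m a) 0:] N = 0"
    by (simp add: coeff_pCons split: nat.split)
  with False show ?thesis
    by (simp add: dickson_frak_def dickson_poly_def pcompose_sum pcompose_monom_monom coeff_sum)
qed

lemma DO_poly_dickson_frak_iff:
  fixes a :: "'a::field"
  assumes p: "CHAR('a) = p" and "a \<noteq> 0" and d: "d \<ge> 1"
  shows "DO_poly p (dickson_frak k m d a) \<longleftrightarrow>
    (\<forall>i. 2 * i < k \<longrightarrow> int p dvd dickson_coeff k m i \<or> DO_exponent p ((k - 2 * i) * d))"
proof -
  let ?c = "\<lambda>i. of_int (dickson_coeff k m i) * (- a) ^ i"
  have zero: "?c i = 0 \<longleftrightarrow> int p dvd dickson_coeff k m i" for i
    using \<open>a \<noteq> 0\<close> p by (simp add: of_int_eq_0_iff_char_dvd)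
  have top: "coeff (dickson_frak k m d a) ((k - 2 * i) * d) = ?c i" if i: "2 * i < k" for i
  proof -
    have "(\<Sum>j\<le>k div 2. if (k - 2 * j) * d = (k - 2 * i) * d then ?c j else 0)
            = (\<Sum>j\<le>k div 2. if j = i then ?c j else 0)"
      using d i by (intro sum.cong) auto
    also have "\<dots> = ?c i" using i by simp
    finally show ?thesis using d i by (simp add: coeff_dickson_frak)
  qed
  have supp: "\<exists>i. 2 * i < k \<and> N = (k - 2 * i) * d"
    if "coeff (dickson_frak k m d a) N \<noteq> 0" for N
  proof -
    from that have N: "N \<noteq> 0"
      and *: "(\<Sum>i\<le>k div 2. if (k - 2 * i) * d = N then ?c i else 0) \<noteq> 0"
      using d by (auto simp: coeff_dickson_frak split: if_splits)
    from sum.not_neutral_contains_not_neutral[OF *] obtain i where "(k - 2 * i) * d = N"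
      by (metis (no_types, lifting))
    with N show ?thesis by (intro exI[of _ i]) (auto simp: not_le)
  qed
  show ?thesis
    unfolding DO_poly_iff using top supp zero by metis
qed

text \<open>
  Translation by 1 permutes the ring, so adding 1 to every element leaves their sum unchanged. This
  identifies the characteristic of a field with \<open>p ^ e\<close> elements as \<open>p\<close>.
\<close>

lemma of_nat_card_UNIV_eq_0: "of_nat (card (UNIV :: 'a set)) = (0 :: 'a::{ring_1, finite})"
proof -
  have "bij (\<lambda>x::'a. x + 1)"
    by (rule bij_betw_byWitness[where f' = "\<lambda>x. x - 1"]) auto
  then have "(\<Sum>x\<in>(UNIV :: 'a set). x + 1) = (\<Sum>x\<in>UNIV. x)"
    by (rule sum.reindex_bij_betw)
  then show ?thesis by (simp add: sum.distrib)
qed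

section \<open>The coefficients modulo a large prime\<close>

text \<open>
  The factor \<open>k - i\<close> of the falling factorial \<open>(k - i) (k - i - 1) \<cdots> (k - 2i + 1)\<close> cancels the
  denominator of the coefficient.
\<close>

lemma fact_mult_dickson_coeff:
  assumes "1 \<le> k" "1 \<le> i" "i \<le> k div 2"
  shows "fact i * dickson_coeff k m i =
           (int k - int m * int i) * (\<Prod>j=1..<i. int k - int i - int j)"
proof -
  have ik: "i < k" using assms by linarith
  have "fact i * int ((k - i) choose i) = (\<Prod>j=0..<i. int (k - i) - int j)"
    by (simp only: int_binomial gbinomial_int_mult_fact)
  also have "\<dots> = (\<Prod>j=0..<i. int k - int i - int j)"
    using ik by (simp add: of_nat_diff)
  also have "\<dots> = (int k - int i) * (\<Prod>j=1..<i. int k - int i - int j)"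
    using assms by (subst prod.atLeast_Suc_lessThan) auto
  finally have binom: "fact i * int ((k - i) choose i) =
      (int k - int i) * (\<Prod>j=1..<i. int k - int i - int j)" .
  have "(int k - int i) * (fact i * dickson_coeff k m i)
          = fact i * ((int k - int i) * dickson_coeff k m i)"
    by (simp only: mult.left_commute)
  also have "\<dots> = (int k - int m * int i) * (fact i * int ((k - i) choose i))"
    using assms by (simp only: dickson_coeff_exact mult.left_commute)
  also have "\<dots> = (int k - int i) *
      ((int k - int m * int i) * (\<Prod>j=1..<i. int k - int i - int j))"
    by (simp only: binom mult.left_commute)
  finally show ?thesis using ik by simp
qed

lemma dvd_dickson_coeff_iff:
  assumes "prime p" "i < p" "1 \<le> k" "1 \<le> i" "i \<le> k div 2"
  shows "int p dvd dickson_coeff k m i \<longleftrightarrow>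
           int p dvd (int k - int m * int i) * (\<Prod>j=1..<i. int k - int i - int j)"
proof -
  have "\<not> p dvd fact i" using assms by (simp add: prime_dvd_fact_iff)
  then have "\<not> int p dvd fact i"
    by (metis int_dvd_int_iff of_nat_fact)
  moreover have "prime (int p)" using assms by simp
  ultimately have "int p dvd dickson_coeff k m i \<longleftrightarrow> int p dvd fact i * dickson_coeff k m i"
    by (simp add: prime_dvd_mult_iff)
  then show ?thesis
    using assms by (simp only: fact_mult_dickson_coeff)
qed

lemma dickson_coeff_0: "1 \<le> k \<Longrightarrow> dickson_coeff k m 0 = 1"
  by (simp add: dickson_coeff_def)

lemma dvd_dickson_coeff_4_1:
  assumes "prime p" "k \<ge> 2"
  shows "int p dvd dickson_coeff k 4 1 \<longleftrightarrow> int p dvd int k - 4"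
proof -
  have "p > 1" using assms prime_gt_1_nat by blast
  then show ?thesis
    using assms by (subst dvd_dickson_coeff_iff) auto
qed

lemma dvd_dickson_coeff_4_2:
  assumes "prime p" "p \<ge> 5" "k \<ge> 4"
  shows "int p dvd dickson_coeff k 4 2 \<longleftrightarrow> int p dvd int k - 8 \<or> int p dvd int k - 3"
proof -
  have "prime (int p)" using assms by simp
  moreover have "{1..<2::nat} = {1}" by auto
  ultimately show ?thesis
    using assms by (subst dvd_dickson_coeff_iff) (auto simp: prime_dvd_mult_iff)
qed

lemma dvd_dickson_coeff_4_4:
  assumes "prime p" "p \<ge> 5" "k \<ge> 8"
  shows "int p dvd dickson_coeff k 4 4 \<longleftrightarrow>
    int p dvd int k - 16 \<or> int p dvd int k - 5 \<or> int p dvd int k - 6 \<or> int p dvd int k - 7"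
proof -
  have "prime (int p)" using assms by simp
  moreover have "{1..<4::nat} = {1, 2, 3}" by auto
  ultimately show ?thesis
    using assms by (subst dvd_dickson_coeff_iff) (auto simp: prime_dvd_mult_iff)
qed

text \<open>
  All differences of roots that occur below are divisors of 24, so one exclusion serves for all of
  them.
\<close>

lemma not_dvd_of_diff_dvd_24:
  fixes x r s :: int
  assumes "prime p" "p \<ge> 5" "int p dvd x - r" "s - r dvd 24"
  shows "\<not> int p dvd x - s"
proof
  assume "int p dvd x - s"
  with assms(3) have "int p dvd (x - r) - (x - s)" by (rule dvd_diff)
  then have "int p dvd 24" using assms(4) by (simp add: dvd_trans)
  then have "int p dvd int (2 ^ 3 * 3)" by simp
  then have "p dvd 2 ^ 3 * 3" by (simp only: int_dvd_int_iff)
  then have "p dvd 2 \<or> p dvd 3"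
    using \<open>prime p\<close> by (metis prime_dvd_mult_iff prime_dvd_power)
  then show False using \<open>p \<ge> 5\<close> by (auto dest!: dvd_imp_le)
qed

section \<open>Rigidity of Dembowski-Ostrom exponents\<close>

lemma prime_power_cofactor_unique:
  fixes p x y :: nat
  assumes "prime p" "p ^ m * x = p ^ n * y" "\<not> p dvd x" "\<not> p dvd y"
  shows "m = n" "x = y"
proof -
  have "multiplicity p (p ^ m * x) = m"
    by (rule multiplicity_eqI) (use assms(1,3) in auto)
  moreover have "multiplicity p (p ^ n * y) = n"
    by (rule multiplicity_eqI) (use assms(1,4) in auto)
  ultimately show "m = n" using assms(2) by simp
  with assms show "x = y" by (simp add: prime_gt_0_nat)
qed

text \<open>
  Since \<open>p ^ \<alpha> + 1\<close> is prime to an odd \<open>p\<close>, even when \<open>\<alpha> = 0\<close>, the power of \<open>p\<close> in a DO exponent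
  is visible as the factor \<open>p ^ m\<close> of its normal form and can be cancelled against \<open>p ^ n\<close>.
\<close>

lemma DO_exponent_multiple:
  fixes p u n e :: nat
  assumes "prime p" "p \<noteq> 2" "\<not> p dvd u" "\<not> p dvd e" "DO_exponent p (u * (p ^ n * e))"
  obtains \<alpha> where "u * e = p ^ \<alpha> + 1"
proof -
  from assms(5) obtain \<alpha> m where m: "u * (p ^ n * e) = p ^ m * (p ^ \<alpha> + 1)"
    unfolding DO_exponent_iff by blast
  have "\<not> p dvd p ^ \<alpha> + 1"
  proof (cases "\<alpha> = 0")
    case True
    have "\<not> p dvd 2"
      using assms(1,2) primes_dvd_imp_eq two_is_prime_nat by blast
    with True show ?thesis by (simp add: numeral_2_eq_2)
  next
    case False
    then have "p dvd p ^ \<alpha>" by simp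
    then show ?thesis using assms(1) by (metis dvd_add_right_iff not_prime_unit)
  qed
  moreover have "\<not> p dvd u * e" using assms by (simp add: prime_dvd_mult_iff)
  moreover have "p ^ n * (u * e) = p ^ m * (p ^ \<alpha> + 1)" using m by (simp add: ac_simps)
  ultimately have "u * e = p ^ \<alpha> + 1"
    using prime_power_cofactor_unique(2) assms(1) by blast
  then show thesis by (rule that)
qed

text \<open>
  After the common power of \<open>p\<close> is removed, the difference \<open>p ^ \<alpha> - p ^ \<beta>\<close> of the two exponents
  is prime to \<open>p\<close>, which leaves only \<open>\<beta> = 0\<close>.
\<close>

lemma two_DO_multiples:
  fixes p u v d :: nat
  assumes p: "prime p" "p \<noteq> 2" and "v < u" and "d \<ge> 1"
    and ndvd: "\<not> p dvd u" "\<not> p dvd v" "\<not> p dvd u - v"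
    and DO: "DO_exponent p (u * d)" "DO_exponent p (v * d)"
  obtains n \<alpha> where "v dvd 2" "v * d = 2 * p ^ n" "u * d = p ^ n * (p ^ \<alpha> + 1)" "\<alpha> > 0"
proof -
  have "\<not> is_unit p" using p by auto
  then obtain n e where d: "d = p ^ n * e" and e: "\<not> p dvd e"
    using multiplicity_decompose'[of d p] \<open>d \<ge> 1\<close>
    by (metis not_one_le_zero)
  obtain \<alpha> where \<alpha>: "u * e = p ^ \<alpha> + 1"
    using DO_exponent_multiple p ndvd(1) e DO(1) unfolding d by metis
  obtain \<beta> where \<beta>: "v * e = p ^ \<beta> + 1"
    using DO_exponent_multiple p ndvd(2) e DO(2) unfolding d by metis
  have "e > 0" using e by (auto intro: Nat.gr0I)
  then have "v * e < u * e" using \<open>v < u\<close> by simp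
  then have "p ^ \<beta> < p ^ \<alpha>" using \<alpha> \<beta> by simp
  then have less: "\<beta> < \<alpha>" using p prime_gt_1_nat power_less_imp_less_exp by blast
  have diff: "(u - v) * e = p ^ \<alpha> - p ^ \<beta>"
    using \<alpha> \<beta> by (simp add: diff_mult_distrib)
  have "\<beta> = 0"
  proof (rule ccontr)
    assume "\<beta> \<noteq> 0"
    then have "p dvd p ^ \<alpha> - p ^ \<beta>" using less by (intro dvd_diff_nat) auto
    with diff have "p dvd (u - v) * e" by simp
    with p ndvd(3) e show False by (simp add: prime_dvd_mult_iff)
  qed
  then have ve: "v * e = 2" using \<beta> by simp
  show thesis
  proof (rule that)
    show "v dvd 2" using ve by (metis dvd_triv_left)
    show "v * d = 2 * p ^ n" using ve unfolding d by (simp add: ac_simps)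
    show "u * d = p ^ n * (p ^ \<alpha> + 1)"
      using \<alpha> unfolding d by (metis mult.left_commute)
    show "\<alpha> > 0" using less by simp
  qed
qed

section \<open>The classification\<close>

lemma DO_exponent_1_3_iff:
  assumes p: "prime p" "p \<ge> 5" and "d \<ge> 1"
  shows "DO_exponent p d \<and> DO_exponent p (3 * d) \<longleftrightarrow> p = 5 \<and> (\<exists>n. d = 2 * p ^ n)"
proof
  assume DO: "DO_exponent p d \<and> DO_exponent p (3 * d)"
  have "\<not> p dvd 3" "\<not> p dvd 1" "\<not> p dvd 3 - 1"
    using p by (auto dest!: dvd_imp_le)
  then obtain n \<alpha> where d: "d = 2 * p ^ n" and "3 * d = p ^ n * (p ^ \<alpha> + 1)" "\<alpha> > 0"
    using two_DO_multiples[of p 1 3 d] p \<open>d \<ge> 1\<close> DO by auto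
  then have "p ^ n * (p ^ \<alpha> + 1) = p ^ n * 6" by simp
  then have "p ^ \<alpha> + 1 = 6"
    using p prime_gt_0_nat by (metis mult_left_cancel power_eq_0_iff not_gr0)
  then have "p dvd 5" using dvd_power[of \<alpha> p] \<open>\<alpha> > 0\<close> by simp
  then have "p = 5" using p(2) by (auto dest!: dvd_imp_le)
  with d show "p = 5 \<and> (\<exists>n. d = 2 * p ^ n)" by blast
next
  assume "p = 5 \<and> (\<exists>n. d = 2 * p ^ n)"
  then obtain n where "p = 5" "d = 2 * 5 ^ n" by auto
  then have "d = p ^ n * (p ^ 0 + 1)" "3 * d = p ^ n * (p ^ 1 + 1)" by simp_all
  then show "DO_exponent p d \<and> DO_exponent p (3 * d)"
    unfolding DO_exponent_iff by blast
qed

text \<open>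
  Modulo \<open>p\<close> the number \<open>k\<close> is one of 0, 2, 4 or none of them; in the last case the first two
  terms already contradict rigidity. When \<open>p\<close> divides \<open>k\<close>, \<open>k - 2\<close> or the second coefficient
  \<open>k - 4\<close>, the term with \<open>i = 2\<close> or \<open>i = 4\<close> takes its place.
\<close>

lemma not_all_DO_exponents_of_ge_6:
  assumes p: "prime p" "p \<ge> 5" and k: "k \<ge> 6" and d: "d \<ge> 1"
  shows "\<not> (\<forall>i. 2 * i < k \<longrightarrow> int p dvd dickson_coeff k 4 i \<or> DO_exponent p ((k - 2 * i) * d))"
proof
  assume DO: "\<forall>i. 2 * i < k \<longrightarrow> int p dvd dickson_coeff k 4 i \<or> DO_exponent p ((k - 2 * i) * d)"
  have p2: "p \<noteq> 2" using p by simp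
  note apart = not_dvd_of_diff_dvd_24[OF p]
  have dvd_nat: "p dvd k - c \<longleftrightarrow> int p dvd int k - int c" if "c \<le> k" for c
    using that by (metis int_dvd_int_iff of_nat_diff)
  have pow2: "\<not> p dvd 2 ^ c" for c
    using p p2 by (metis prime_dvd_power primes_dvd_imp_eq two_is_prime_nat)
  have le2: "v \<le> 2" if "v dvd 2" for v :: nat
    using that by (auto dest: dvd_imp_le)
  have rigid: "v dvd 2"
    if "v < u" "\<not> p dvd u" "\<not> p dvd v" "\<not> p dvd u - v"
      "DO_exponent p (u * d)" "DO_exponent p (v * d)" for u v
    using two_DO_multiples[OF p(1) p2 that(1) d that(2-)] by blast
  have DO0: "DO_exponent p (k * d)"
    using DO[rule_format, of 0] k p by (auto simp: dickson_coeff_0)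
  have DO1: "DO_exponent p ((k - 2) * d)" if "\<not> int p dvd int k - 4"
    using DO[rule_format, of 1] k p that dvd_dickson_coeff_4_1[of p k] by auto
  have DO2: "DO_exponent p ((k - 4) * d)"
    if "\<not> int p dvd int k - 8" "\<not> int p dvd int k - 3"
    using DO[rule_format, of 2] k p that dvd_dickson_coeff_4_2[of p k] by auto
  consider (zero) "int p dvd int k - 0" | (two) "int p dvd int k - 2"
    | (four) "int p dvd int k - 4"
    | (other) "\<not> int p dvd int k - 0" "\<not> int p dvd int k - 2" "\<not> int p dvd int k - 4"
    by blast
  then show False
  proof cases
    case zero
    have "DO_exponent p ((k - 2) * d)" by (rule DO1) (rule apart[OF zero], simp)
    moreover have "DO_exponent p ((k - 4) * d)"
      by (rule DO2) (rule apart[OF zero], simp)+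
    moreover have "\<not> p dvd k - 2" "\<not> p dvd k - 4"
      using apart[OF zero, of 2] apart[OF zero, of 4] k by (simp_all add: dvd_nat)
    moreover have "\<not> p dvd (k - 2) - (k - 4)"
    proof -
      have "(k - 2) - (k - 4) = 2 ^ 1" using k by simp
      then show ?thesis using pow2 by metis
    qed
    moreover have "k - 4 < k - 2" using k by simp
    ultimately have "k - 4 dvd 2" using rigid by blast
    then have "k = 6" using k le2 by force
    with apart[OF zero, of 6] show False by simp
  next
    case two
    have "DO_exponent p ((k - 4) * d)"
      by (rule DO2) (rule apart[OF two], simp)+
    moreover have "\<not> p dvd k" "\<not> p dvd k - 4"
      using apart[OF two, of 0] apart[OF two, of 4] k dvd_nat[of 0] by (simp_all add: dvd_nat)
    moreover have "\<not> p dvd k - (k - 4)" using pow2[of 2] k by simp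
    moreover have "k - 4 < k" using k by simp
    ultimately have "k - 4 dvd 2" using rigid DO0 by blast
    then have "k = 6" using k le2 by force
    with apart[OF two, of 6] show False by simp
  next
    case four
    have "k \<noteq> 6" "k \<noteq> 7" "k \<noteq> 8"
      using apart[OF four, of 6] apart[OF four, of 7] apart[OF four, of 8] by auto
    then have k9: "k \<ge> 9" using k by simp
    have "\<not> int p dvd dickson_coeff k 4 4"
      using k9 p apart[OF four, of 16] apart[OF four, of 5] apart[OF four, of 6]
        apart[OF four, of 7] dvd_dickson_coeff_4_4[of p k] by simp
    then have "DO_exponent p ((k - 8) * d)"
      using DO[rule_format, of 4] k9 by auto
    moreover have "\<not> p dvd k" "\<not> p dvd k - 8"
      using apart[OF four, of 0] apart[OF four, of 8] k9 dvd_nat[of 0] by (simp_all add: dvd_nat)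
    moreover have "\<not> p dvd k - (k - 8)" using pow2[of 3] k9 by simp
    moreover have "k - 8 < k" using k9 by simp
    ultimately obtain n \<alpha> where v: "k - 8 dvd 2" "(k - 8) * d = 2 * p ^ n"
        "k * d = p ^ n * (p ^ \<alpha> + 1)" "\<alpha> > 0"
      using two_DO_multiples[OF p(1) p2 _ d _ _ _ DO0] by blast
    have "k \<noteq> 10" using apart[OF four, of 10] by auto
    with k9 le2[OF v(1)] have "k = 9" by simp
    with four have "p dvd 5" using dvd_nat[of 4] by simp
    then have "p = 5" using p(2) by (auto dest!: dvd_imp_le)
    with v \<open>k = 9\<close> have "5 ^ n * (5 ^ \<alpha> + 1) = 5 ^ n * (18::nat)" by simp
    then have "5 ^ \<alpha> = (17::nat)" by simp
    then have "5 dvd (17::nat)" using \<open>\<alpha> > 0\<close> by (metis dvd_power)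
    then show False by simp
  next
    case other
    have "\<not> p dvd k" "\<not> p dvd k - 2"
      using other k by (simp_all add: dvd_nat)
    moreover have "\<not> p dvd k - (k - 2)" using pow2[of 1] k by simp
    moreover have "k - 2 < k" using k by simp
    ultimately have "k - 2 dvd 2" using rigid DO0 DO1[OF other(3)] by blast
    then show False using k le2 by force
  qed
qed

theorem theorem4p1:
  fixes p q e k d :: nat
    and a :: "'a::{field, finite}"
  assumes "prime p" and "p \<ge> 5"
    and "q = p ^ e" and "e \<ge> 1" and "card (UNIV :: 'a set) = q"
    and "a \<noteq> 0"
    and "k \<ge> 1" and "d \<ge> 1"
  shows "DO_poly p (dickson_frak k 4 d a) \<longleftrightarrow>
    (k = 1 \<and> (\<exists>\<alpha> n. d = p ^ n * (p ^ \<alpha> + 1)))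
    \<or> (k = 2 \<and> (\<exists>\<alpha> n. real d = real (p ^ n * (p ^ \<alpha> + 1)) / 2))
    \<or> (k = 4 \<and> (\<exists>\<alpha> n. real d = real (p ^ n * (p ^ \<alpha> + 1)) / 4))
    \<or> (k \<in> {3, 5} \<and> p = 5 \<and> (\<exists>n. d = 2 * p ^ n))"
proof -
  note p = \<open>prime p\<close> \<open>p \<ge> 5\<close>
  have "prime CHAR('a)"
    by (intro prime_CHAR_semidom finite_imp_CHAR_pos) simp
  moreover have "CHAR('a) dvd p ^ e"
    using of_nat_card_UNIV_eq_0[where 'a = 'a] unfolding assms(3,5)
    by (simp only: of_nat_eq_0_iff_char_dvd)
  ultimately have char: "CHAR('a) = p"
    using \<open>prime p\<close> by (metis prime_dvd_power primes_dvd_imp_eq)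
  let ?D = "\<lambda>i. int p dvd dickson_coeff k 4 i \<or> DO_exponent p ((k - 2 * i) * d)"
  have DO: "DO_poly p (dickson_frak k 4 d a) \<longleftrightarrow> (\<forall>i. 2 * i < k \<longrightarrow> ?D i)"
    by (rule DO_poly_dickson_frak_iff) fact+
  have D0: "?D 0 \<longleftrightarrow> DO_exponent p (k * d)"
    using p \<open>k \<ge> 1\<close> by (simp add: dickson_coeff_0)
  have real_iff: "real d = real N / 2 \<longleftrightarrow> 2 * d = N" "real d = real N / 4 \<longleftrightarrow> 4 * d = N" for N
    by linarith+
  have small: "\<not> int p dvd 1" "\<not> int p dvd 2" "\<not> int p dvd 3"
    using p by (auto dest!: zdvd_imp_le)
  consider "k = 1" | "k = 2" | "k = 3" | "k = 4" | "k = 5" | "k \<ge> 6"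
    using \<open>k \<ge> 1\<close> by linarith
  then show ?thesis
  proof cases
    case 1
    then have "(\<forall>i. 2 * i < k \<longrightarrow> ?D i) \<longleftrightarrow> ?D 0" by auto
    then show ?thesis unfolding DO D0 using 1 by (simp add: DO_exponent_iff)
  next
    case 2
    have "2 * i < 2 \<longleftrightarrow> i = 0" for i :: nat by linarith
    with 2 have "(\<forall>i. 2 * i < k \<longrightarrow> ?D i) \<longleftrightarrow> ?D 0" by metis
    then show ?thesis unfolding DO D0 real_iff using 2 by (simp add: DO_exponent_iff)
  next
    case 3
    have "2 * i < 3 \<longleftrightarrow> i = 0 \<or> i = 1" for i :: nat by linarith
    with 3 have "(\<forall>i. 2 * i < k \<longrightarrow> ?D i) \<longleftrightarrow> ?D 0 \<and> ?D 1" by metis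
    moreover have "?D 1 \<longleftrightarrow> DO_exponent p d"
      using 3 dvd_dickson_coeff_4_1[of p k] p small by simp
    ultimately show ?thesis
      unfolding DO D0 using 3 DO_exponent_1_3_iff[OF p \<open>d \<ge> 1\<close>] by auto
  next
    case 4
    have "2 * i < 4 \<longleftrightarrow> i = 0 \<or> i = 1" for i :: nat by linarith
    with 4 have "(\<forall>i. 2 * i < k \<longrightarrow> ?D i) \<longleftrightarrow> ?D 0 \<and> ?D 1" by metis
    moreover have "?D 1"
      using 4 dvd_dickson_coeff_4_1[of p k] p by simp
    ultimately show ?thesis
      unfolding DO D0 real_iff using 4 by (simp add: DO_exponent_iff)
  next
    case 5
    have "2 * i < 5 \<longleftrightarrow> i = 0 \<or> i = 1 \<or> i = 2" for i :: nat by linarith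
    with 5 have "(\<forall>i. 2 * i < k \<longrightarrow> ?D i) \<longleftrightarrow> ?D 0 \<and> ?D 1 \<and> ?D 2" by metis
    moreover have "?D 1 \<longleftrightarrow> DO_exponent p (3 * d)"
      using 5 dvd_dickson_coeff_4_1[of p k] p small by simp
    moreover have "?D 2 \<longleftrightarrow> DO_exponent p d"
      using 5 dvd_dickson_coeff_4_2[of p k] p small by simp
    \<comment> \<open>The leading term imposes no further condition, because its degree factor 5 equals \<open>p\<close>.\<close>
    moreover have "DO_exponent p (5 * d)" if d: "p = 5" "d = 2 * p ^ n" for n
    proof -
      have "5 * d = p ^ Suc n * (p ^ 0 + 1)" using d by simp
      then show ?thesis unfolding DO_exponent_iff by blast
    qed
    ultimately show ?thesis
      unfolding DO D0 using 5 DO_exponent_1_3_iff[OF p \<open>d \<ge> 1\<close>] by auto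
  next
    case 6
    with not_all_DO_exponents_of_ge_6[OF p 6 \<open>d \<ge> 1\<close>] show ?thesis
      unfolding DO by auto
  qed
qed

end
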